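(* Let $r,n$ be positive integers with $r\equiv2\pmod4$. Then $$\sum_{\pi\in A_{r,n}}q^{\mathrm{RtlMin}_A(\pi)}=2^{n-1}\prod_{i=1}^n\Bigl(\tfrac r2(q+i-1)+1-q\Bigr).$$
   Context: $G_{r,n}=\mathbb{Z}_r\wr S_n$ is the set of pairs $(\vec z,\tau)$ with $\vec z=(z_1,\dots,z_n)\in\{0,\dots,r-1\}^n$, $\tau\in S_n$, with product $(\vec z,\tau)(\vec z',\tau')=((z_1+z'_{\tau^{-1}(1)},\dots,z_n+z'_{\tau^{-1}(n)}),\tau\circ\tau')$, addition mod $r$. For $\pi=(\vec z,\tau)$ put $a_i=\tau(i)$ and $c_i=z_{\tau(i)}$, so that in window notation $\pi=(a_1^{[c_1]}\cdots a_n^{[c_n]})$. The generator $s_0$ is the pair with vector $(1,0,\dots,0)$ and identity permutation; for $1\le i\le n-1$, $s_i$ is the pair with zero vector and transposition $(i\ i+1)$. $A_{r,n}$ is the kernel of the homomorphism $G_{r,n}\to\{\pm1\}$ sending every $s_i$, $0\le i\le n-1$, to $-1$. For $\pi=(a_1^{[c_1]}\cdots a_n^{[c_n]})\in A_{r,n}$, $\mathrm{RtlMin}_A(\pi)=\bigl|\{a_i : a_j>a_i\text{ for all }j>i,\ \text{and } c_i\notin\{0,\tfrac r2\}\}\bigr|$, where the digits $a_i,a_j\in\{1,\dots,n\}$ are compared as integers. *)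

theory Defs
  imports "HOL-Algebra.Sym_Groups"
begin

type_synonym colored_perm = "(nat \<Rightarrow> nat) \<times> (nat \<Rightarrow> nat)"

definition colored_mult :: "nat \<Rightarrow> nat \<Rightarrow> colored_perm \<Rightarrow> colored_perm \<Rightarrow> colored_perm" where
  "colored_mult r n \<pi> \<pi>' =
     ((\<lambda>i\<in>{1..n}. (fst \<pi> i + fst \<pi>' (inv_into UNIV (snd \<pi>) i)) mod r), snd \<pi> \<circ> snd \<pi>')"

text \<open>
  The wreath product of \<open>\<int>\<^sub>r\<close> with \<open>S\<^sub>n\<close>. Vectors are extensional functions on \<open>{1..n}\<close>
  (so that the carrier is finite), and residues are represented by \<open>{0..<r}\<close>.
\<close>

definition colored_group :: "nat \<Rightarrow> nat \<Rightarrow> colored_perm monoid" where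
  "colored_group r n =
     \<lparr> carrier = ({1..n} \<rightarrow>\<^sub>E {0..<r}) \<times> {\<tau>. \<tau> permutes {1..n}},
       mult = colored_mult r n,
       one = ((\<lambda>i\<in>{1..n}. 0), id) \<rparr>"

text \<open>The reduction mod \<open>r\<close> only matters for \<open>r = 1\<close>, where the residue of 1 is 0.\<close>

definition colored_gen :: "nat \<Rightarrow> nat \<Rightarrow> nat \<Rightarrow> colored_perm" where
  "colored_gen r n i =
     (if i = 0 then ((\<lambda>j\<in>{1..n}. if j = 1 then 1 mod r else 0), id)
      else ((\<lambda>j\<in>{1..n}. 0), transpose i (i + 1)))"

text \<open>
  The homomorphism sending every generator to \<open>-1\<close>; the group \<open>{\<plusminus>1}\<close> is \<^term>\<open>sign_img\<close>.
  It exists only for even \<open>r\<close>. The extensionality requirement makes it unique as a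
  function on the whole type.
\<close>

definition gen_sign :: "nat \<Rightarrow> nat \<Rightarrow> colored_perm \<Rightarrow> int" where
  "gen_sign r n =
     (THE \<phi>. \<phi> \<in> hom (colored_group r n) sign_img \<and>
             \<phi> \<in> extensional (carrier (colored_group r n)) \<and>
             (\<forall>i<n. \<phi> (colored_gen r n i) = -1))"

definition alt_colored :: "nat \<Rightarrow> nat \<Rightarrow> colored_perm set" where
  "alt_colored r n = kernel (colored_group r n) sign_img (gen_sign r n)"

text \<open>The window notation of \<open>\<pi> = (z, \<tau>)\<close>: digits \<open>a\<^sub>i = \<tau>(i)\<close> and colors \<open>c\<^sub>i = z\<^bsub>\<tau>(i)\<^esub>\<close>.\<close>

definition digit :: "colored_perm \<Rightarrow> nat \<Rightarrow> nat" where
  "digit \<pi> i = snd \<pi> i"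

definition color :: "colored_perm \<Rightarrow> nat \<Rightarrow> nat" where
  "color \<pi> i = fst \<pi> (snd \<pi> i)"

definition RtlMin_A :: "nat \<Rightarrow> nat \<Rightarrow> colored_perm \<Rightarrow> nat" where
  "RtlMin_A r n \<pi> =
     card {digit \<pi> i | i. i \<in> {1..n} \<and>
             (\<forall>j\<in>{1..n}. i < j \<longrightarrow> digit \<pi> i < digit \<pi> j) \<and>
             color \<pi> i \<noteq> 0 \<and> 2 * color \<pi> i \<noteq> r}"

end

theory Submission
  imports Defs "HOL-Combinatorics.Multiset_Permutations"
begin

text \<open>
  A homomorphism to \<open>{\<plusminus>1}\<close> is constant on conjugacy classes, so the values on the generators
  determine it on all transpositions and all elementary colorings: it is
  \<open>(z, \<tau>) \<mapsto> sgn \<tau> \<sdot> (-1)\<^bsup>z\<^sub>1 + \<dots> + z\<^sub>n\<^esup>\<close>. Write \<open>r = 2 m\<close>. Since \<open>m\<close> is odd, exactly one of the colors \<open>c\<close>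
  and \<open>c + m\<close> has a prescribed parity, while the statistic depends on the colors mod \<open>m\<close> only.
  Hence, for fixed \<open>\<tau>\<close>, the sum over the admissible colorings is \<open>2\<^bsup>n - 1\<^esup>\<close> times a product with a factor
  \<open>x = 1 + (m - 1) q\<close> for each right-to-left minimum of \<open>\<tau>\<close> and a factor \<open>m\<close> for each other digit.
  Choosing the entries of \<open>\<tau>\<close> from left to right, the sum over \<open>\<tau>\<close> is the product of
  \<open>x + (i - 1) m\<close> over \<open>i = 1, \<dots>, n\<close>.
\<close>

section \<open>The sign homomorphism\<close>

lemma carrier_colored_group:
  "carrier (colored_group r n) = ({1..n} \<rightarrow>\<^sub>E {0..<r}) \<times> {\<tau>. \<tau> permutes {1..n}}"
  by (simp add: colored_group_def)

lemma colored_group_mult: "x \<otimes>\<^bsub>colored_group r n\<^esub> y = colored_mult r n x y"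
  by (simp add: colored_group_def)

definition colored_sign :: "nat \<Rightarrow> colored_perm \<Rightarrow> int" where
  "colored_sign n \<pi> = sign (snd \<pi>) * (-1) ^ (\<Sum>i=1..n. fst \<pi> i)"

lemma minus_one_power_mod:
  assumes "even r"
  shows "(-1 :: 'a :: ring_1) ^ (k mod r) = (-1) ^ k"
  using assms by (auto simp: minus_one_power_iff dvd_mod_iff)

text \<open>Reduction modulo the even \<open>r\<close> preserves parity, and the shift of the second
  vector by the inverse of \<open>snd x\<close> only permutes the factors of the product of
  signs.\<close>

lemma colored_sign_mult:
  assumes "even r" "snd x permutes {1..n}" "snd y permutes {1..n}"
  shows "colored_sign n (colored_mult r n x y) = colored_sign n x * colored_sign n y"
proof -
  let ?p = "inv_into UNIV (snd x)"
  have "(-1 :: int) ^ (\<Sum>i=1..n. (\<lambda>i\<in>{1..n}. (fst x i + fst y (?p i)) mod r) i)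
      = (\<Prod>i=1..n. (-1) ^ ((fst x i + fst y (?p i)) mod r))"
    by (simp add: power_sum)
  also have "\<dots> = (-1) ^ (\<Sum>i=1..n. fst x i) * (\<Prod>i=1..n. (-1) ^ fst y (?p i))"
    using assms(1) by (simp add: minus_one_power_mod power_add prod.distrib power_sum)
  also have "(\<Prod>i=1..n. (-1 :: int) ^ fst y (?p i)) = (\<Prod>i=1..n. (-1) ^ fst y i)"
    using prod.permute[OF permutes_inv[OF assms(2)], of "\<lambda>i. (-1 :: int) ^ fst y i"]
    by (simp add: o_def)
  finally have "(-1 :: int) ^ (\<Sum>i=1..n. fst (colored_mult r n x y) i)
      = (-1) ^ (\<Sum>i=1..n. fst x i) * (-1) ^ (\<Sum>i=1..n. fst y i)"
    by (simp add: colored_mult_def power_sum)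
  moreover have "sign (snd x \<circ> snd y) = sign (snd x) * sign (snd y)"
    using assms by (intro sign_compose) (auto intro: permutes_imp_permutation)
  ultimately show ?thesis
    by (simp add: colored_sign_def colored_mult_def)
qed

lemma colored_mult_closed:
  assumes "r > 0" "x \<in> carrier (colored_group r n)" "y \<in> carrier (colored_group r n)"
  shows "colored_mult r n x y \<in> carrier (colored_group r n)"
  using assms by (auto simp: carrier_colored_group colored_mult_def intro: permutes_compose)

lemma colored_gen_carrier:
  assumes "r > 0" "i < n"
  shows "colored_gen r n i \<in> carrier (colored_group r n)"
  using assms by (auto simp: carrier_colored_group colored_gen_def permutes_id
      intro!: permutes_swap_id)

lemma colored_sign_gen:
  assumes "even r" "i < n"
  shows "colored_sign n (colored_gen r n i) = -1"
proof (cases "i = 0")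
  case True
  have "(\<Sum>j=1..n. (\<lambda>j\<in>{1..n}. if j = 1 then 1 mod r else 0) j)
      = (\<Sum>j\<in>{1..n}. if j = 1 then 1 mod r else 0)"
    by simp
  also have "\<dots> = 1 mod r"
    using assms(2) by (subst sum.delta) auto
  finally show ?thesis
    using True minus_one_power_mod[OF assms(1), of 1, where 'a = int]
    by (simp add: colored_sign_def colored_gen_def)
next
  case False
  then show ?thesis
    by (simp add: colored_sign_def colored_gen_def sign_swap_id)
qed

lemma restrict_colored_sign_hom:
  assumes "even r" "r > 0"
  shows "restrict (colored_sign n) (carrier (colored_group r n)) \<in> hom (colored_group r n) sign_img"
proof (rule homI)
  fix x assume "x \<in> carrier (colored_group r n)"
  then show "restrict (colored_sign n) (carrier (colored_group r n)) x \<in> carrier sign_img"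
    by (simp add: colored_sign_def sign_def minus_one_power_iff sign_img_def)
next
  fix x y assume "x \<in> carrier (colored_group r n)" "y \<in> carrier (colored_group r n)"
  moreover from this have "snd x permutes {1..n}" "snd y permutes {1..n}"
    by (auto simp: carrier_colored_group)
  ultimately show "restrict (colored_sign n) (carrier (colored_group r n)) (x \<otimes>\<^bsub>colored_group r n\<^esub> y)
      = restrict (colored_sign n) (carrier (colored_group r n)) x \<otimes>\<^bsub>sign_img\<^esub>
        restrict (colored_sign n) (carrier (colored_group r n)) y"
    using assms by (simp add: colored_group_mult colored_mult_closed sign_img_def colored_sign_mult
        del: One_nat_def)
qed

section \<open>Uniqueness of the sign homomorphism\<close>

context
  fixes r n :: nat and \<phi> :: "colored_perm \<Rightarrow> int"
  assumes r: "r > 0" "even r"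
    and hom: "\<phi> \<in> hom (colored_group r n) sign_img"
    and gen: "\<And>i. i < n \<Longrightarrow> \<phi> (colored_gen r n i) = -1"
begin

private abbreviation "zero_vec \<equiv> (\<lambda>i\<in>{1..n}. 0) :: nat \<Rightarrow> nat"
private abbreviation "unit_vec k \<equiv> (\<lambda>j\<in>{1..n}. if j = k then 1 mod r else 0) :: nat \<Rightarrow> nat"

private lemma hom_mult_carrier:
  "x \<in> carrier (colored_group r n) \<Longrightarrow> y \<in> carrier (colored_group r n) \<Longrightarrow>
    \<phi> (colored_mult r n x y) = \<phi> x * \<phi> y"
  using hom_mult[OF hom] by (simp add: colored_group_mult sign_img_def)

private lemma hom_nonzero: "x \<in> carrier (colored_group r n) \<Longrightarrow> \<phi> x \<noteq> 0"
  using hom_in_carrier[OF hom, of x] by (auto simp: sign_img_def)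

private lemma perm_carrier:
  "\<tau> permutes {1..n} \<Longrightarrow> (zero_vec, \<tau>) \<in> carrier (colored_group r n)"
  using r by (auto simp: carrier_colored_group)

private lemma diag_carrier:
  "z \<in> {1..n} \<rightarrow>\<^sub>E {0..<r} \<Longrightarrow> (z, id) \<in> carrier (colored_group r n)"
  by (simp add: carrier_colored_group permutes_id del: One_nat_def)

private lemma unit_vec_carrier: "unit_vec k \<in> {1..n} \<rightarrow>\<^sub>E {0..<r}"
  using r by auto

private lemma hom_perm_mult:
  assumes "\<sigma> permutes {1..n}" "\<tau> permutes {1..n}"
  shows "\<phi> (zero_vec, \<sigma> \<circ> \<tau>) = \<phi> (zero_vec, \<sigma>) * \<phi> (zero_vec, \<tau>)"
proof -
  have "colored_mult r n (zero_vec, \<sigma>) (zero_vec, \<tau>) = (zero_vec, \<sigma> \<circ> \<tau>)"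
    using permutes_in_image[OF permutes_inv[OF assms(1)]]
    by (auto simp: colored_mult_def fun_eq_iff restrict_def)
  then show ?thesis
    using hom_mult_carrier[OF perm_carrier[OF assms(1)] perm_carrier[OF assms(2)]] by simp
qed

text \<open>The semidirect decomposition: it reduces \<phi> to its values on pure colorings and on
  pure permutations.\<close>

private lemma hom_split:
  assumes "z \<in> {1..n} \<rightarrow>\<^sub>E {0..<r}" "\<tau> permutes {1..n}"
  shows "\<phi> (z, \<tau>) = \<phi> (z, id) * \<phi> (zero_vec, \<tau>)"
proof -
  have "(\<lambda>i\<in>{1..n}. (z i + zero_vec (inv_into UNIV id i)) mod r) = z"
    using assms(1) by (intro ext) (auto simp: restrict_def PiE_iff extensional_def)
  then have "colored_mult r n (z, id) (zero_vec, \<tau>) = (z, \<tau>)"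
    by (simp add: colored_mult_def)
  then show ?thesis
    using hom_mult_carrier[OF diag_carrier[OF assms(1)] perm_carrier[OF assms(2)]] by simp
qed

text \<open>Conjugating \<open>transpose a b\<close> by the generator
  \<open>transpose b (Suc b)\<close> gives \<open>transpose a (Suc b)\<close>. The values commute
  and are nonzero, so conjugates have equal values, and induction on \<open>b\<close> starts from a
  generator.\<close>

private lemma hom_transpose_less:
  assumes "1 \<le> a" "Suc a \<le> b" "b \<le> n"
  shows "\<phi> (zero_vec, transpose a b) = -1"
  using assms(2,3)
proof (induction b rule: dec_induct)
  case base
  then show "\<phi> (zero_vec, transpose a (Suc a)) = -1"
    using gen[of a] assms(1) by (simp add: colored_gen_def)
next
  case (step b)
  have ab: "transpose a b permutes {1..n}" "transpose b (Suc b) permutes {1..n}"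
      "transpose a (Suc b) permutes {1..n}"
    using step assms(1) by (auto intro!: permutes_swap_id)
  have "transpose b (Suc b) \<circ> transpose a b = transpose a (Suc b) \<circ> transpose b (Suc b)"
    using step by (auto simp: fun_eq_iff transpose_def)
  then have "\<phi> (zero_vec, transpose b (Suc b)) * \<phi> (zero_vec, transpose a b)
      = \<phi> (zero_vec, transpose a (Suc b)) * \<phi> (zero_vec, transpose b (Suc b))"
    using ab by (metis hom_perm_mult)
  moreover have "\<phi> (zero_vec, transpose a b) = -1"
    using step by (intro step.IH) simp
  ultimately show "\<phi> (zero_vec, transpose a (Suc b)) = -1"
    using hom_nonzero[OF perm_carrier[OF ab(2)]] by simp
qed

private lemma hom_transpose:
  assumes "a \<in> {1..n}" "b \<in> {1..n}" "a \<noteq> b"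
  shows "\<phi> (zero_vec, transpose a b) = -1"
  using assms hom_transpose_less[of a b] hom_transpose_less[of b a]
  by (cases "a < b") (auto simp: transpose_commute)

private lemma hom_perm:
  assumes "\<tau> permutes {1..n}"
  shows "\<phi> (zero_vec, \<tau>) = sign \<tau>"
  using assms finite_atLeastAtMost
proof (induction \<tau> rule: permutes_induct)
  case id
  have "\<phi> (zero_vec, id) = \<phi> (zero_vec, id) * \<phi> (zero_vec, id)"
    using hom_perm_mult[OF permutes_id permutes_id] by simp
  then show "\<phi> (zero_vec, id) = sign id"
    using hom_nonzero[OF perm_carrier[OF permutes_id]] by simp
next
  case (swap a b p)
  have "transpose a b permutes {1..n}"
    using swap by (intro permutes_swap_id) auto
  moreover have "\<phi> (zero_vec, p) = sign p"
    by (rule swap.IH)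
  ultimately have "\<phi> (zero_vec, transpose a b \<circ> p) = - sign p"
    using swap.hyps by (simp add: hom_perm_mult hom_transpose del: One_nat_def)
  also have "\<dots> = sign (transpose a b \<circ> p)"
    using swap by (subst sign_compose)
      (auto simp: sign_swap_id permutation_swap_id intro: permutes_imp_permutation)
  finally show ?case .
qed

text \<open>Up to conjugation by \<open>transpose 1 k\<close>, this is the generator with index 0.
  The conjugation appears as two factorizations of \<open>(unit_vec k, transpose 1 k)\<close>, from
  which the common nonzero value cancels.\<close>

private lemma hom_unit_vec:
  assumes "k \<in> {1..n}"
  shows "\<phi> (unit_vec k, id) = -1"
proof -
  let ?t = "transpose 1 k"
  have t: "?t permutes {1..n}"
    using assms by (intro permutes_swap_id) auto
  have "(\<lambda>i\<in>{1..n}. (zero_vec i + unit_vec 1 (inv_into UNIV ?t i)) mod r) = unit_vec k"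
    using assms by (auto simp: fun_eq_iff transpose_def restrict_def)
  then have "colored_mult r n (zero_vec, ?t) (unit_vec 1, id) = (unit_vec k, ?t)"
    by (simp add: colored_mult_def)
  then have "\<phi> (zero_vec, ?t) * \<phi> (unit_vec 1, id) = \<phi> (unit_vec k, id) * \<phi> (zero_vec, ?t)"
    using hom_mult_carrier[OF perm_carrier[OF t] diag_carrier[OF unit_vec_carrier]]
      hom_split[OF unit_vec_carrier t] by metis
  then have "\<phi> (unit_vec k, id) = \<phi> (unit_vec 1, id)"
    using hom_nonzero[OF perm_carrier[OF t]] by simp
  then show ?thesis
    using gen[of 0] assms by (simp add: colored_gen_def)
qed

text \<open>Induction on the sum of the colors as natural numbers: one unit vector is split off at a
  place of positive color, and each contributes a factor -1.\<close>

private lemma hom_diag: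
  assumes "z \<in> {1..n} \<rightarrow>\<^sub>E {0..<r}"
  shows "\<phi> (z, id) = (-1) ^ (\<Sum>i=1..n. z i)"
  using assms
proof (induction "\<Sum>i=1..n. z i" arbitrary: z)
  case 0
  then have "z = zero_vec"
    by (intro ext) (auto simp: PiE_iff extensional_def restrict_def)
  then show "\<phi> (z, id) = (-1) ^ (\<Sum>i=1..n. z i)"
    using hom_perm[OF permutes_id] by simp
next
  case (Suc m)
  then obtain k where k: "k \<in> {1..n}" "z k > 0"
    by (metis Zero_not_Suc gr0I sum.neutral)
  define w where "w = z(k := z k - 1)"
  have w: "w \<in> {1..n} \<rightarrow>\<^sub>E {0..<r}"
    using Suc.prems k by (auto simp: w_def PiE_iff extensional_def less_imp_diff_less)
  have z: "z = w(k := Suc (w k))"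
    using k by (auto simp: w_def)
  have "sum w ({1..n} - {k}) = sum z ({1..n} - {k})"
    by (intro sum.cong) (auto simp: w_def)
  then have "(\<Sum>i=1..n. z i) = Suc (\<Sum>i=1..n. w i)"
    using k sum.remove[of "{1..n}" k z] sum.remove[of "{1..n}" k w] by (simp add: w_def)
  then have IH: "m = (\<Sum>i=1..n. w i)"
    using Suc by simp
  have "(\<lambda>i\<in>{1..n}. (unit_vec k i + w (inv_into UNIV id i)) mod r) = z"
  proof
    fix i
    \<comment> \<open>\<open>Suc (w k)\<close> is the old color \<open>z k\<close>, so adding the
      unit vector back never wraps around modulo \<open>r\<close>.\<close>
    have "Suc (w k) < r" "w i < r" if "i \<in> {1..n}"
      using Suc.prems w k that by (auto simp: w_def PiE_iff)
    moreover have "w i = undefined" if "i \<notin> {1..n}"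
      using w that by (auto simp: PiE_iff extensional_def)
    ultimately show "(\<lambda>i\<in>{1..n}. (unit_vec k i + w (inv_into UNIV id i)) mod r) i = z i"
      using r(2) k(1) by (cases "i \<in> {1..n}") (auto simp: z mod_simps)
  qed
  then have "colored_mult r n (unit_vec k, id) (w, id) = (z, id)"
    by (simp add: colored_mult_def)
  then have "\<phi> (z, id) = - \<phi> (w, id)"
    using hom_mult_carrier[OF diag_carrier[OF unit_vec_carrier] diag_carrier[OF w], of k]
      hom_unit_vec[OF k(1)] by simp
  also have "\<dots> = (-1) ^ Suc m"
    using Suc.hyps(1)[OF IH w] IH by simp
  finally show ?case
    using Suc.hyps(2) by simp
qed

lemma hom_eq_colored_sign:
  assumes "x \<in> carrier (colored_group r n)"
  shows "\<phi> x = colored_sign n x"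
  using assms hom_split[of "fst x" "snd x"] hom_diag[of "fst x"] hom_perm[of "snd x"]
  by (cases x) (simp add: carrier_colored_group colored_sign_def del: One_nat_def)

end

section \<open>The alternating subgroup as a parity condition\<close>

lemma gen_sign_eq:
  assumes "even r" "r > 0"
  shows "gen_sign r n = restrict (colored_sign n) (carrier (colored_group r n))"
  unfolding gen_sign_def
proof (rule the_equality, intro conjI allI impI)
  show "restrict (colored_sign n) (carrier (colored_group r n)) \<in> hom (colored_group r n) sign_img"
    using assms by (rule restrict_colored_sign_hom)
next
  fix i assume "i < n"
  then show "restrict (colored_sign n) (carrier (colored_group r n)) (colored_gen r n i) = -1"
    using assms by (simp add: colored_gen_carrier colored_sign_gen)
next
  fix \<phi>
  assume "\<phi> \<in> hom (colored_group r n) sign_img \<and> \<phi> \<in> extensional (carrier (colored_group r n)) \<and>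
    (\<forall>i<n. \<phi> (colored_gen r n i) = -1)"
  then show "\<phi> = restrict (colored_sign n) (carrier (colored_group r n))"
    using assms hom_eq_colored_sign[of r \<phi> n]
    by (intro extensionalityI[of _ "carrier (colored_group r n)"]) auto
qed auto

text \<open>The product of the two signs is 1 exactly when the color sum and the permutation have
  the same parity. The pairs are swapped so that \<tau> can be fixed first and the colors summed
  inside.\<close>

lemma alt_colored_eq:
  assumes "even r" "r > 0"
  shows "alt_colored r n = (\<lambda>(\<tau>, z). (z, \<tau>)) ` (SIGMA \<tau>:{\<tau>. \<tau> permutes {1..n}}.
    {z \<in> {1..n} \<rightarrow>\<^sub>E {0..<r}. even (\<Sum>i=1..n. z i) = evenperm \<tau>})"
  using assms
  by (auto simp: alt_colored_def kernel_def gen_sign_eq sign_img_def carrier_colored_group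
      colored_sign_def sign_def minus_one_power_iff image_iff split: if_splits)

section \<open>Summation over the colors\<close>

lemma sum_lessThan_add:
  fixes f :: "nat \<Rightarrow> 'a :: comm_monoid_add"
  shows "sum f {..<m + k} = sum f {..<m} + (\<Sum>i<k. f (m + i))"
  by (induction k) (simp_all add: add.assoc)

text \<open>As \<open>m\<close> is odd, \<open>c\<close> and \<open>m + c\<close> have opposite
  parities, so each pair contributes its common value \<open>g c\<close> exactly once.\<close>

lemma sum_fixed_parity:
  fixes g :: "nat \<Rightarrow> 'a :: comm_monoid_add"
  assumes "odd m" "\<And>c. g (m + c) = g c"
  shows "(\<Sum>c<2 * m. if even c = b then g c else 0) = (\<Sum>c<m. g c)"
proof -
  have "(\<Sum>c<2 * m. if even c = b then g c else 0)
      = (\<Sum>c<m. (if even c = b then g c else 0) + (if even (m + c) = b then g (m + c) else 0))"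
    unfolding mult_2 sum_lessThan_add sum.distrib ..
  also have "\<dots> = (\<Sum>c<m. g c)"
    using assms by (intro sum.cong) auto
  finally show ?thesis .
qed

text \<open>The color at one chosen place absorbs the parity condition, so the others become free.\<close>

lemma sum_PiE_fixed_parity:
  fixes g :: "'i \<Rightarrow> nat \<Rightarrow> 'a :: comm_ring_1"
  assumes "finite I" "I \<noteq> {}" "odd m" "\<And>i c. g i (m + c) = g i c"
  shows "(\<Sum>z | z \<in> I \<rightarrow>\<^sub>E {..<2 * m} \<and> even (sum z I) = b. \<Prod>i\<in>I. g i (z i))
    = 2 ^ (card I - 1) * (\<Prod>i\<in>I. \<Sum>c<m. g i c)"
proof -
  from assms(2) obtain a where "a \<in> I"
    by blast
  define J where "J = I - {a}"
  have J: "I = insert a J" "a \<notin> J" "finite J"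
    using \<open>a \<in> I\<close> assms(1) by (auto simp: J_def)
  let ?P = "J \<rightarrow>\<^sub>E {..<2 * m}"
  have fin: "finite (I \<rightarrow>\<^sub>E {..<2 * m})" "finite ?P"
    using assms(1) J(3) by (auto intro: finite_PiE)
  have "(\<Sum>z | z \<in> I \<rightarrow>\<^sub>E {..<2 * m} \<and> even (sum z I) = b. \<Prod>i\<in>I. g i (z i))
      = (\<Sum>z\<in>I \<rightarrow>\<^sub>E {..<2 * m}. if even (sum z I) = b then \<Prod>i\<in>I. g i (z i) else 0)"
    using fin by (simp add: sum.inter_filter)
  also have "\<dots> = (\<Sum>(c, z)\<in>{..<2 * m} \<times> ?P. if even (sum (z(a := c)) I) = b
      then \<Prod>i\<in>I. g i ((z(a := c)) i) else 0)"
    unfolding J(1) PiE_insert_eq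
    by (subst sum.reindex[OF inj_combinator[OF J(2)]]) (simp add: case_prod_unfold)
  \<comment> \<open>For fixed \<open>z\<close>, the parity required of the whole sum becomes a
    parity required of \<open>c\<close> alone.\<close>
  also have "\<dots> = (\<Sum>(c, z)\<in>{..<2 * m} \<times> ?P. if even c = (even (sum z J) = b)
      then g a c * (\<Prod>i\<in>J. g i (z i)) else 0)"
  proof (intro sum.cong refl, clarify)
    fix c z
    have "sum (z(a := c)) J = sum z J" "(\<Prod>i\<in>J. g i ((z(a := c)) i)) = (\<Prod>i\<in>J. g i (z i))"
      using J(2) by (auto intro!: sum.cong prod.cong)
    then show "(if even (sum (z(a := c)) I) = b then \<Prod>i\<in>I. g i ((z(a := c)) i) else 0)
        = (if even c = (even (sum z J) = b) then g a c * (\<Prod>i\<in>J. g i (z i)) else 0)"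
      using J by auto
  qed
  also have "\<dots> = (\<Sum>z\<in>?P. \<Sum>c<2 * m. if even c = (even (sum z J) = b)
      then g a c * (\<Prod>i\<in>J. g i (z i)) else 0)"
    by (subst sum.cartesian_product[symmetric], subst sum.swap) simp
  also have "\<dots> = (\<Sum>z\<in>?P. \<Sum>c<m. g a c * (\<Prod>i\<in>J. g i (z i)))"
    using assms(3,4) by (intro sum.cong refl sum_fixed_parity) auto
  also have "\<dots> = (\<Sum>c<m. g a c) * (\<Sum>z\<in>?P. \<Prod>i\<in>J. g i (z i))"
    by (simp add: sum_distrib_right sum_distrib_left)
  also have "(\<Sum>z\<in>?P. \<Prod>i\<in>J. g i (z i)) = (\<Prod>i\<in>J. \<Sum>c<2 * m. g i c)"
    using J(3) by (subst prod_sum_PiE) auto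
  \<comment> \<open>Each free color runs through two periods of \<open>g i\<close>; this is the
    source of the power of 2, with exponent \<open>card J = card I - 1\<close>.\<close>
  also have "\<dots> = (\<Prod>i\<in>J. 2 * (\<Sum>c<m. g i c))"
    by (simp only: mult_2[of m] sum_lessThan_add assms(4) mult_2[of "sum _ _"])
  also have "\<dots> = 2 ^ card J * (\<Prod>i\<in>J. \<Sum>c<m. g i c)"
    by (simp add: prod.distrib)
  finally show ?thesis
    using J by (simp add: ac_simps)
qed

section \<open>Right-to-left minima of permutations\<close>

text \<open>The product of \<open>x\<close> for each right-to-left minimum and \<open>y\<close> for
  each other entry. In a list the entries further right form the tail, which makes the recursion
  structural.\<close>

fun rtl_min_weight :: "'a :: comm_ring_1 \<Rightarrow> 'a \<Rightarrow> 'b :: linorder list \<Rightarrow> 'a" where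
  "rtl_min_weight x y [] = 1"
| "rtl_min_weight x y (a # as) = (if \<forall>b\<in>set as. a < b then x else y) * rtl_min_weight x y as"

text \<open>The first entry is a right-to-left minimum exactly when it is the least entry.\<close>

lemma sum_rtl_min_weight:
  assumes "finite A"
  shows "(\<Sum>xs\<in>permutations_of_set A. rtl_min_weight x y xs) =
    (\<Prod>i=1..card A. x + (of_nat i - 1) * y)"
  using assms
proof (induction "card A" arbitrary: A)
  case 0
  then show ?case
    by simp
next
  case (Suc k)
  then have ne: "A \<noteq> {}"
    by auto
  have "(\<Sum>xs\<in>permutations_of_set A. rtl_min_weight x y xs)
      = (\<Sum>a\<in>A. \<Sum>xs\<in>(#) a ` permutations_of_set (A - {a}). rtl_min_weight x y xs)"
    unfolding permutations_of_set_nonempty[OF ne]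
    using Suc.prems by (intro sum.UNION_disjoint) auto
  also have "\<dots> = (\<Sum>a\<in>A. (if a = Min A then x else y) *
      (\<Sum>xs\<in>permutations_of_set (A - {a}). rtl_min_weight x y xs))"
  proof (intro sum.cong refl)
    fix a assume a: "a \<in> A"
    have min: "(\<forall>b\<in>A - {a}. a < b) \<longleftrightarrow> a = Min A"
      using a Suc.prems ne eq_Min_iff[of A a] by (auto simp: less_le)
    have "(\<Sum>xs\<in>(#) a ` permutations_of_set (A - {a}). rtl_min_weight x y xs)
        = (\<Sum>xs\<in>permutations_of_set (A - {a}). rtl_min_weight x y (a # xs))"
      by (subst sum.reindex) auto
    also have "\<dots> = (\<Sum>xs\<in>permutations_of_set (A - {a}).
        (if a = Min A then x else y) * rtl_min_weight x y xs)"
    proof (intro sum.cong refl)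
      fix xs assume "xs \<in> permutations_of_set (A - {a})"
      then have "set xs = A - {a}"
        by (rule permutations_of_setD)
      then show "rtl_min_weight x y (a # xs) = (if a = Min A then x else y) * rtl_min_weight x y xs"
        using min by simp
    qed
    finally show "(\<Sum>xs\<in>(#) a ` permutations_of_set (A - {a}). rtl_min_weight x y xs)
        = (if a = Min A then x else y) *
          (\<Sum>xs\<in>permutations_of_set (A - {a}). rtl_min_weight x y xs)"
      by (simp add: sum_distrib_left)
  qed
  also have "\<dots> = (\<Sum>a\<in>A. (if a = Min A then x else y) * (\<Prod>i=1..k. x + (of_nat i - 1) * y))"
  proof (intro sum.cong refl)
    fix a assume "a \<in> A"
    then have "k = card (A - {a})" "finite (A - {a})"
      using Suc by auto
    then show "(if a = Min A then x else y) *
          (\<Sum>xs\<in>permutations_of_set (A - {a}). rtl_min_weight x y xs)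
        = (if a = Min A then x else y) * (\<Prod>i=1..k. x + (of_nat i - 1) * y)"
      using Suc.hyps(1)[of "A - {a}"] by simp
  qed
  \<comment> \<open>The sum over the remaining entries is the same for every first entry, so it
    factors out.\<close>
  also have "\<dots> = (\<Sum>a\<in>A. if a = Min A then x else y) * (\<Prod>i=1..k. x + (of_nat i - 1) * y)"
    by (simp add: sum_distrib_right)
  \<comment> \<open>Of the \<open>Suc k\<close> possible first entries only the minimum has weight
    \<open>x\<close>; the result is the factor for \<open>i = Suc k\<close>.\<close>
  also have "(\<Sum>a\<in>A. if a = Min A then x else y) = x + of_nat k * y"
  proof -
    have "(\<Sum>a\<in>A. if a = Min A then x else y) = x + (\<Sum>a\<in>A - {Min A}. if a = Min A then x else y)"
      using Suc.prems ne by (subst sum.remove[of _ "Min A"]) auto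
    also have "(\<Sum>a\<in>A - {Min A}. if a = Min A then x else y) = of_nat (card (A - {Min A})) * y"
      by simp
    also have "card (A - {Min A}) = k"
      using Suc ne by (simp add: card_Diff_singleton Suc.hyps(2)[symmetric])
    finally show ?thesis .
  qed
  finally show ?case
    using Suc.hyps(2)[symmetric] by (simp add: mult.commute)
qed

section \<open>From lists to permutations and their windows\<close>

lemma rtl_min_weight_map_upt:
  assumes "k \<le> m"
  shows "rtl_min_weight x y (map f [k..<m]) =
    (\<Prod>i=k..<m. if \<forall>j\<in>{i<..<m}. f i < f j then x else y)"
  using assms
proof (induction rule: inc_induct)
  case base
  then show ?case
    by simp
next
  case (step k)
  then show ?case
    by (simp add: upt_conv_Cons prod.atLeast_Suc_lessThan atLeastSucLessThan_greaterThanLessThan)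
qed

lemma bij_betw_permutes_lists:
  "bij_betw (\<lambda>\<tau>. map \<tau> [1..<Suc n]) {\<tau>. \<tau> permutes {1..n}} (permutations_of_set {1..n})"
proof -
  let ?f = "\<lambda>\<tau>. map \<tau> [1..<Suc n]"
  have inj: "inj_on ?f {\<tau>. \<tau> permutes {1..n}}"
  proof (intro inj_onI ext)
    fix \<sigma> \<tau> :: "nat \<Rightarrow> nat" and i
    assume *: "\<sigma> \<in> {\<tau>. \<tau> permutes {1..n}}" "\<tau> \<in> {\<tau>. \<tau> permutes {1..n}}" "?f \<sigma> = ?f \<tau>"
    then have "\<forall>i\<in>{1..n}. \<sigma> i = \<tau> i"
      by (auto simp del: upt_Suc)
    then show "\<sigma> i = \<tau> i"
      using * by (cases "i \<in> {1..n}") (auto simp: permutes_not_in simp del: upt_Suc)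
  qed
  have sub: "?f ` {\<tau>. \<tau> permutes {1..n}} \<subseteq> permutations_of_set {1..n}"
  proof (clarify, rule permutations_of_setI)
    fix \<tau> assume *: "\<tau> permutes {1..n}"
    have "set [1..<Suc n] = {1..n}"
      by (auto simp del: upt_Suc)
    then show "set (map \<tau> [1..<Suc n]) = {1..n}"
      using permutes_image[OF *] by (simp del: upt_Suc)
    show "distinct (map \<tau> [1..<Suc n])"
      using permutes_inj[OF *] by (auto simp: distinct_map simp del: upt_Suc intro: inj_on_subset)
  qed
  \<comment> \<open>Surjectivity by counting: the image lies in a finite set of the same
    cardinality.\<close>
  have "card (?f ` {\<tau>. \<tau> permutes {1..n}}) = card (permutations_of_set {1..n})"
    using inj by (simp add: card_image card_permutations del: upt_Suc)
  then show ?thesis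
    using inj card_subset_eq[OF finite_permutations_of_set sub] by (simp add: bij_betw_def)
qed

text \<open>Digits are collected rather than positions because color vectors are indexed by digits:
  the digit \<open>v\<close> carries the color \<open>z v\<close>.\<close>

definition rtl_minima :: "nat \<Rightarrow> (nat \<Rightarrow> nat) \<Rightarrow> nat set" where
  "rtl_minima n \<tau> = {\<tau> i | i. i \<in> {1..n} \<and> (\<forall>j\<in>{1..n}. i < j \<longrightarrow> \<tau> i < \<tau> j)}"

text \<open>Substituting \<open>v = \<tau> i\<close> turns the product over digits into one over
  positions, which is the weight of the window of \<tau>; the windows are all the orderings of
  \<open>{1..n}\<close>.\<close>

lemma sum_permutes_rtl_minima:
  "(\<Sum>\<tau> | \<tau> permutes {1..n}. \<Prod>v=1..n. if v \<in> rtl_minima n \<tau> then x else y)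
    = (\<Prod>i=1..n. x + (of_nat i - 1) * y)" for x y :: "'a :: comm_ring_1"
proof -
  have "(\<Prod>v=1..n. if v \<in> rtl_minima n \<tau> then x else y) = rtl_min_weight x y (map \<tau> [1..<Suc n])"
    if \<tau>: "\<tau> permutes {1..n}" for \<tau>
  proof -
    have "(\<Prod>v=1..n. if v \<in> rtl_minima n \<tau> then x else y)
        = (\<Prod>i=1..n. if \<tau> i \<in> rtl_minima n \<tau> then x else y)"
      using prod.permute[OF \<tau>, of "\<lambda>v. if v \<in> rtl_minima n \<tau> then x else y"] by (simp add: o_def)
    also have "\<dots> = (\<Prod>i=1..<Suc n. if \<forall>j\<in>{i<..<Suc n}. \<tau> i < \<tau> j then x else y)"
    proof (rule prod.cong)
      show "{1..n} = {1..<Suc n}"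
        by auto
      fix i assume i: "i \<in> {1..<Suc n}"
      have "\<tau> i \<in> rtl_minima n \<tau> \<longleftrightarrow> (\<forall>j\<in>{1..n}. i < j \<longrightarrow> \<tau> i < \<tau> j)"
        using i permutes_inj[OF \<tau>] by (auto simp: rtl_minima_def inj_eq)
      also have "\<dots> \<longleftrightarrow> (\<forall>j\<in>{i<..<Suc n}. \<tau> i < \<tau> j)"
        using i by auto
      finally show "(if \<tau> i \<in> rtl_minima n \<tau> then x else y)
          = (if \<forall>j\<in>{i<..<Suc n}. \<tau> i < \<tau> j then x else y)"
        by simp
    qed
    also have "\<dots> = rtl_min_weight x y (map \<tau> [1..<Suc n])"
      by (rule rtl_min_weight_map_upt[symmetric]) simp
    finally show ?thesis .
  qed
  then have "(\<Sum>\<tau> | \<tau> permutes {1..n}. \<Prod>v=1..n. if v \<in> rtl_minima n \<tau> then x else y)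
      = (\<Sum>\<tau> | \<tau> permutes {1..n}. rtl_min_weight x y (map \<tau> [1..<Suc n]))"
    by (intro sum.cong) auto
  also have "\<dots> = (\<Sum>xs\<in>permutations_of_set {1..n}. rtl_min_weight x y xs)"
    by (rule sum.reindex_bij_betw[OF bij_betw_permutes_lists])
  also have "\<dots> = (\<Prod>i=1..n. x + (of_nat i - 1) * y)"
    by (subst sum_rtl_min_weight) auto
  finally show ?thesis .
qed

section \<open>The statistic as a product over digits\<close>

text \<open>The multiples of \<open>m\<close> below \<open>2 * m\<close> are 0 and \<open>m\<close>,
  exactly the two excluded colors. Written with divisibility, the factor at each digit has period
  \<open>m\<close> in its color.\<close>

lemma power_RtlMin_A:
  assumes \<tau>: "\<tau> permutes {1..n}" and "z \<in> {1..n} \<rightarrow>\<^sub>E {0..<2 * m}"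
  shows "(q :: 'a :: comm_ring_1) ^ RtlMin_A (2 * m) n (z, \<tau>) =
    (\<Prod>v=1..n. if v \<in> rtl_minima n \<tau> \<and> \<not> m dvd z v then q else 1)"
proof -
  have "m dvd c \<longleftrightarrow> c = 0 \<or> c = m" if "c < 2 * m" for c
    using that by (auto elim!: dvdE simp: less_2_cases_iff)
  then have col: "z v \<noteq> 0 \<and> 2 * z v \<noteq> 2 * m \<longleftrightarrow> \<not> m dvd z v" if "v \<in> {1..n}" for v
    using that assms by (fastforce simp: PiE_iff)
  have "{digit (z, \<tau>) i | i. i \<in> {1..n} \<and>
      (\<forall>j\<in>{1..n}. i < j \<longrightarrow> digit (z, \<tau>) i < digit (z, \<tau>) j) \<and>
      color (z, \<tau>) i \<noteq> 0 \<and> 2 * color (z, \<tau>) i \<noteq> 2 * m}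
    = {v \<in> {1..n}. v \<in> rtl_minima n \<tau> \<and> \<not> m dvd z v}" (is "?L = ?R")
  proof (intro equalityI subsetI)
    fix v assume "v \<in> ?L"
    then obtain i where i: "v = \<tau> i" "i \<in> {1..n}" "\<forall>j\<in>{1..n}. i < j \<longrightarrow> \<tau> i < \<tau> j"
      "z v \<noteq> 0 \<and> 2 * z v \<noteq> 2 * m"
      unfolding digit_def color_def by auto
    moreover have "v \<in> {1..n}"
      using i permutes_in_image[OF \<tau>] by blast
    ultimately show "v \<in> ?R"
      using col unfolding rtl_minima_def by blast
  next
    fix v assume "v \<in> ?R"
    then show "v \<in> ?L"
      using col[of v] unfolding rtl_minima_def digit_def color_def by fastforce
  qed
  then have "q ^ RtlMin_A (2 * m) n (z, \<tau>) = q ^ card {v \<in> {1..n}. v \<in> rtl_minima n \<tau> \<and> \<not> m dvd z v}"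
    by (simp only: RtlMin_A_def)
  also have "\<dots> = (\<Prod>v=1..n. if v \<in> rtl_minima n \<tau> \<and> \<not> m dvd z v then q else 1)"
    by (simp add: prod.inter_filter[symmetric])
  finally show ?thesis .
qed

theorem theorem7p11:
  fixes r n :: nat and q :: "'a :: comm_ring_1"
  assumes "r > 0" and "n > 0" and "r mod 4 = 2"
  shows "(\<Sum>\<pi>\<in>alt_colored r n. q ^ RtlMin_A r n \<pi>) =
         2 ^ (n - 1) * (\<Prod>i=1..n. of_nat (r div 2) * (q + of_nat i - 1) + 1 - q)"
proof -
  define m where "m = r div 2"
  have m: "r = 2 * m" "odd m" "m > 0" "even r"
    using assms unfolding m_def by presburger+
  define x where "x = 1 + (of_nat m - 1) * q"
  define Z where "Z \<tau> = {z \<in> {1..n} \<rightarrow>\<^sub>E {0..<r}. even (\<Sum>i=1..n. z i) = evenperm \<tau>}" for \<tau> :: "nat \<Rightarrow> nat"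
  define g where "g \<tau> v c = (if v \<in> rtl_minima n \<tau> \<and> \<not> m dvd c then q else 1)" for \<tau> v c
  have g: "(\<Sum>c<m. g \<tau> v c) = (if v \<in> rtl_minima n \<tau> then x else of_nat m)" for \<tau> v
  proof -
    \<comment> \<open>Among the colors below \<open>m\<close> only 0 is divisible by
      \<open>m\<close>: it gives 1, and the other \<open>m - 1\<close> give \<open>q\<close>
      each.\<close>
    have "(\<Sum>c<m. if \<not> m dvd c then q else 1) = x"
    proof -
      have "(\<Sum>c<m. if \<not> m dvd c then q else 1) = 1 + (\<Sum>c\<in>{..<m} - {0}. if \<not> m dvd c then q else 1)"
        using m(3) by (subst sum.remove[of _ 0]) auto
      also have "(\<Sum>c\<in>{..<m} - {0}. if \<not> m dvd c then q else 1) = (\<Sum>c\<in>{..<m} - {0}. q)"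
        by (intro sum.cong refl) (auto dest: dvd_imp_le)
      also have "\<dots> = (of_nat m - 1) * q"
        using m(3) by (simp add: card_Diff_singleton of_nat_diff)
      finally show ?thesis
        by (simp add: x_def)
    qed
    then show ?thesis
      by (simp add: g_def)
  qed
  have fin: "finite {\<tau>. \<tau> permutes {1..n}}" "finite (Z \<tau>)" for \<tau>
    by (auto simp: Z_def finite_permutations intro!: finite_PiE)
  have "(\<Sum>\<pi>\<in>alt_colored r n. q ^ RtlMin_A r n \<pi>)
      = (\<Sum>(\<tau>, z)\<in>(SIGMA \<tau>:{\<tau>. \<tau> permutes {1..n}}. Z \<tau>). q ^ RtlMin_A r n (z, \<tau>))"
    unfolding alt_colored_eq[OF m(4) assms(1)] Z_def
    by (subst sum.reindex) (auto simp: inj_on_def case_prod_unfold)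
  also have "\<dots> = (\<Sum>\<tau> | \<tau> permutes {1..n}. \<Sum>z\<in>Z \<tau>. q ^ RtlMin_A r n (z, \<tau>))"
    using fin by (subst sum.Sigma) auto
  also have "\<dots> = (\<Sum>\<tau> | \<tau> permutes {1..n}. \<Sum>z\<in>Z \<tau>. \<Prod>v=1..n. g \<tau> v (z v))"
    by (intro sum.cong refl) (simp add: Z_def g_def power_RtlMin_A m(1) del: One_nat_def)
  also have "\<dots> = (\<Sum>\<tau> | \<tau> permutes {1..n}.
      2 ^ (n - 1) * (\<Prod>v=1..n. if v \<in> rtl_minima n \<tau> then x else of_nat m))"
  proof (intro sum.cong refl)
    fix \<tau>
    show "(\<Sum>z\<in>Z \<tau>. \<Prod>v=1..n. g \<tau> v (z v))
        = 2 ^ (n - 1) * (\<Prod>v=1..n. if v \<in> rtl_minima n \<tau> then x else of_nat m)"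
      \<comment> \<open>The prescribed parity is that of \<tau>; \<open>n > 0\<close> makes the
        index set nonempty.\<close>
      using sum_PiE_fixed_parity[of "{1..n}" m "g \<tau>" "evenperm \<tau>"] assms(2) m(2)
      by (simp add: Z_def g m(1) atLeast0LessThan g_def[of _ _ "m + _"] g_def[symmetric])
  qed
  also have "\<dots> = 2 ^ (n - 1) * (\<Prod>i=1..n. x + (of_nat i - 1) * of_nat m)"
    by (simp add: sum_distrib_left[symmetric] sum_permutes_rtl_minima del: One_nat_def)
  \<comment> \<open>Factor by factor,
    \<open>1 + (m - 1) * q + (i - 1) * m = m * (q + i - 1) + 1 - q\<close>.\<close>
  also have "(\<Prod>i=1..n. x + (of_nat i - 1) * of_nat m)
      = (\<Prod>i=1..n. of_nat (r div 2) * (q + of_nat i - 1) + 1 - q)"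
    by (intro prod.cong refl) (simp add: x_def m_def algebra_simps)
  finally show ?thesis .
qed

end
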